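(* Consider the coalescing skip-free process of the checkerboard construction with deterministic initial condition $\eta$ (a subset of occupied sites at time $0$). Run the system for time $T$, and let $a_1<b_1\le a_2<b_2\le\cdots\le a_n<b_n$ be positions of dual (half-integer) vertices at time $T$. Then $$\mathbb{P}\big(\text{no wall in any }(a_i,b_i),\ i=1,\dots,n\big)=\operatorname{Pf}(A),$$ where, with $x_1,\dots,x_{2n}$ denoting the endpoints $a_1,b_1,\dots,a_n,b_n$ in this order, $A$ is the $2n\times 2n$ antisymmetric matrix whose entry $A_{kl}$ $(k<l)$ is the probability that independent backward particles started from $x_k$ and $x_l$ either (a) cross or meet during the $T$ steps, or (b) do not cross or meet but $\eta$ has no particle between their final positions.
   Context: Checkerboard construction. Let $\mathbb{Z}'=\mathbb{Z}+\tfrac12$. Weights $p_{u,v}\in[0,1]$, $(u,v)\in\mathbb{Z}^2$, are given (possibly varying from vertex to vertex). Independently for each $(u,v)\in\mathbb{Z}^2$ a binary choice is made. With probability $p_{u,v}$: the forward edge at $(u,v)$ goes East, to $(u+1,v)$, and the backward edge at $(u+\frac12,v+\frac12)\in(\mathbb{Z}')^2$ goes West, to $(u-\frac12,v+\frac12)$. With probability $1-p_{u,v}$: the forward edge at $(u,v)$ goes North, to $(u,v+1)$, and the backward edge at $(u+\frac12,v+\frac12)$ goes South, to $(u+\frac12,v-\frac12)$. Time is $t=u+v$; on each diagonal $u+v=t$ ($t\in\mathbb{Z}$) the vertices of $\mathbb{Z}^2$ and of $(\mathbb{Z}')^2$ are linearly ordered, and their position is recorded, by the $u$-coordinate (integers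 and half-integers respectively). Forward process: a particle (boundary) starts at each site of the diagonal $u+v=0$ of $\mathbb{Z}^2$ belonging to $\eta$; particles follow the forward edges and coalesce when they meet. The "walls" at time $T$ (a positive integer) are the surviving forward particles (boundaries) on the diagonal $u+v=T$; "no wall in $(a,b)$" means that there is none with position strictly between $a$ and $b$, for $a,b\in\mathbb{Z}'$. Backward particles: a backward particle starts at a vertex of $(\mathbb{Z}')^2$ on the diagonal $u+v=T$ and makes $T$ random steps down to the diagonal $u+v=0$; from $(u+\frac12,v+\frac12)$ it moves to $(u-\frac12,v+\frac12)$ with probability $p_{u,v}$ and to $(u+\frac12,v-\frac12)$ with probability $1-p_{u,v}$. Independent backward particles use independent randomness. They "cross or meet" if at some diagonal they occupy the same position or their order is reversed (which, for this skip-free motion, requires meeting). The final position is the position on the diagonal $u+v=0$; "$\eta$ has no particle between the final positions" means that no element of $\eta$ has position strictly between them. $\operatorname{Pf}$ denotes the Pfaffian. *)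

theory Defs
  imports "HOL-Probability.Probability" "HOL-Combinatorics.Permutations"
begin

text \<open>
  A choice is a boolean: \<^term>\<open>True\<close> stands for East (forward) and West (backward),
  \<^term>\<open>False\<close> for North (forward) and South (backward).
\<close>

definition checkerboard :: "(int \<times> int \<Rightarrow> real) \<Rightarrow> (int \<times> int \<Rightarrow> bool) measure" where
  "checkerboard p = PiM UNIV (\<lambda>z. measure_pmf (bernoulli_pmf (p z)))"

fun forward_edge :: "bool \<Rightarrow> int \<times> int \<Rightarrow> int \<times> int" where
  "forward_edge c (u, v) = (if c then (u + 1, v) else (u, v + 1))"

fun backward_edge :: "bool \<Rightarrow> real \<times> real \<Rightarrow> real \<times> real" where
  "backward_edge c (x, y) = (if c then (x - 1, y) else (x, y - 1))"

definition forward_step :: "(int \<times> int \<Rightarrow> bool) \<Rightarrow> int \<times> int \<Rightarrow> int \<times> int" where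
  "forward_step \<omega> z = forward_edge (\<omega> z) z"

text \<open>
  The position of a vertex on its diagonal is its first coordinate. Forward particles that
  meet follow the same edges from then on, so coalescence amounts to taking the set of
  positions reached.
\<close>

definition walls :: "int set \<Rightarrow> nat \<Rightarrow> (int \<times> int \<Rightarrow> bool) \<Rightarrow> int set" where
  "walls \<eta> T \<omega> = (\<lambda>u. fst ((forward_step \<omega> ^^ T) (u, - u))) ` \<eta>"

definition half_ints :: "real set" where
  "half_ints = range (\<lambda>k::int. of_int k + 1 / 2)"

text \<open>
  The dual vertex \<open>(u + 1/2, v + 1/2)\<close> uses the weight at \<open>(u, v)\<close>, which is
  obtained by taking floors.
\<close>

fun backward_step :: "(int \<times> int \<Rightarrow> real) \<Rightarrow> real \<times> real \<Rightarrow> (real \<times> real) pmf" where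
  "backward_step p (x, y) =
     map_pmf (\<lambda>c. backward_edge c (x, y)) (bernoulli_pmf (p (\<lfloor>x\<rfloor>, \<lfloor>y\<rfloor>)))"

text \<open>The law of the list of the \<open>T + 1\<close> vertices visited in \<open>T\<close> steps, the start included.\<close>

fun backward_path :: "(int \<times> int \<Rightarrow> real) \<Rightarrow> nat \<Rightarrow> real \<times> real \<Rightarrow> (real \<times> real) list pmf" where
  "backward_path p 0 z = return_pmf [z]"
| "backward_path p (Suc T) z =
     bind_pmf (backward_step p z) (\<lambda>z'. map_pmf (\<lambda>zs. z # zs) (backward_path p T z'))"

text \<open>
  For paths started on the same diagonal, the first one not to the right of the second;
  equal starting points count as meeting.
\<close>

definition cross_or_meet :: "(real \<times> real) list \<Rightarrow> (real \<times> real) list \<Rightarrow> bool" where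
  "cross_or_meet zs ws \<longleftrightarrow>
     (\<exists>s < length zs. fst (zs ! s) = fst (ws ! s) \<or> fst (ws ! s) < fst (zs ! s))"

definition empty_between_ends :: "int set \<Rightarrow> (real \<times> real) list \<Rightarrow> (real \<times> real) list \<Rightarrow> bool" where
  "empty_between_ends \<eta> zs ws \<longleftrightarrow>
     real_of_int ` \<eta> \<inter> {fst (last zs) <..< fst (last ws)} = {}"

definition pair_prob :: "(int \<times> int \<Rightarrow> real) \<Rightarrow> int set \<Rightarrow> nat \<Rightarrow> real \<Rightarrow> real \<Rightarrow> real" where
  "pair_prob p \<eta> T x y =
     measure_pmf.prob
       (pair_pmf (backward_path p T (x, real T - x)) (backward_path p T (y, real T - y)))
       {(zs, ws). cross_or_meet zs ws \<or> (\<not> cross_or_meet zs ws \<and> empty_between_ends \<eta> zs ws)}"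

definition antisym_matrix :: "(nat \<Rightarrow> nat \<Rightarrow> real) \<Rightarrow> nat \<Rightarrow> nat \<Rightarrow> real" where
  "antisym_matrix q k l = (if k < l then q k l else if l < k then - q l k else 0)"

text \<open>
  The Pfaffian of a \<open>2n \<times> 2n\<close> antisymmetric matrix with rows and columns indexed from 0.
\<close>

definition pfaffian :: "nat \<Rightarrow> (nat \<Rightarrow> nat \<Rightarrow> real) \<Rightarrow> real" where
  "pfaffian n A =
     (\<Sum>\<sigma> | \<sigma> permutes {..<2 * n}.
        real_of_int (sign \<sigma>) * (\<Prod>i<n. A (\<sigma> (2 * i)) (\<sigma> (2 * i + 1)))) / (2 ^ n * fact n)"

definition endpoints :: "(nat \<Rightarrow> real) \<Rightarrow> (nat \<Rightarrow> real) \<Rightarrow> nat \<Rightarrow> real" where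
  "endpoints a b k = (if even k then a (k div 2) else b (k div 2))"

end

theory Submission
  imports Defs
begin

text \<open>
  Write \<open>B x\<close> for the end at time \<open>0\<close> of the backward path that starts at the dual vertex with
  position \<open>x\<close> and follows the backward edges of the environment. Backward and forward edges do not
  cross, so there is no wall in \<open>(a, b)\<close> exactly when \<open>\<eta>\<close> has no particle between \<open>B a\<close> and
  \<open>B b\<close> (\<open>no_wall_iff_dual\<close>). The left-hand side is thus the probability that \<open>\<eta>\<close> has no particle
  between \<open>B x\<^sub>2\<^sub>i\<^sub>-\<^sub>1\<close> and \<open>B x\<^sub>2\<^sub>i\<close> for every \<open>i\<close>, where the paths \<open>B\<close> coalesce because they share
  their environment, whereas the entries of the matrix concern two independent particles.

  The lemma \<open>no_wall_prob_eq_pfaffian\<close> proves the formula for arbitrary weakly increasing starting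
  points, by showing that both sides obey the same recursion.

  First, suppose that neighbouring particles \<open>k\<close> and \<open>k + 1\<close> start at the same vertex. On the left
  they can be deleted: they either bound a trivial gap or separate two gaps that merge
  (\<open>gaps_free_delete\<close>). On the right, rows \<open>k\<close> and \<open>k + 1\<close> agree outside the entry
  \<open>(k, k + 1)\<close>, which is 1. Exchanging the two rows cancels all matchings that do not contain the edge
  \<open>{k, k + 1}\<close>, and what remains is the Pfaffian without these rows (\<open>pfaffian_delete_equal_rows\<close>).

  Second, if all starting points are distinct, the first steps of the coalescing particles use
  different sites and are independent. A summand of the Pfaffian contains every index in exactly one
  factor, so the average of the Pfaffian over the first steps is the Pfaffian of
  the averaged entries (\<open>pfaffian_expectation\<close>), and averaging an entry adds one unit of
  time to it (\<open>pair_prob_Suc\<close>).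

  At time \<open>0\<close> the entries are indicators of empty gaps. The deletion argument works
  for any empty gap between neighbours, and when no such gap is left both sides are zero.
\<close>

section \<open>Deleting two equal rows of a Pfaffian\<close>

definition pfaffian_term :: "(nat \<Rightarrow> nat \<Rightarrow> real) \<Rightarrow> nat \<Rightarrow> (nat \<Rightarrow> nat) \<Rightarrow> real" where
  "pfaffian_term A n \<sigma> = real_of_int (sign \<sigma>) * (\<Prod>i<n. A (\<sigma> (2 * i)) (\<sigma> (2 * i + 1)))"

text \<open>
The permutation that carries the last two of the positions \<open>0, \<dots>, m + 1\<close> to \<open>k\<close> and
\<open>k + 1\<close> and keeps the order of the others. On \<open>j < m\<close> it is the increasing
enumeration of the indices that remain when \<open>k\<close> and \<open>k + 1\<close> are deleted.
\<close>

definition pair_at :: "nat \<Rightarrow> nat \<Rightarrow> nat \<Rightarrow> nat" where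
  "pair_at k m j = (if j < k then j else if j < m then j + 2
     else if j = m then k else if j = Suc m then Suc k else j)"

text \<open>
Each decrease of \<open>k\<close> moves the pair past one more index, which is a 3-cycle.
\<close>

lemma pair_at_even_permutation:
  assumes "k \<le> m"
  shows "pair_at k m permutes {..<Suc (Suc m)} \<and> sign (pair_at k m) = 1"
  using assms
proof (induction rule: inc_induct)
  case base
  have id: "pair_at m m = id" by (auto simp: pair_at_def fun_eq_iff)
  show ?case unfolding id using permutes_id sign_id by blast
next
  case (step k)
  define c where "c = Transposition.transpose (Suc k) (Suc (Suc k)) \<circ> Transposition.transpose k (Suc k)"
  have eq: "pair_at k m = c \<circ> pair_at (Suc k) m"
    using step(2) by (auto simp: pair_at_def c_def fun_eq_iff Transposition.transpose_def)
  have c: "c permutes {..<Suc (Suc m)}"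
    unfolding c_def using step(2) by (intro permutes_compose permutes_swap_id) auto
  have s: "sign c = 1"
    unfolding c_def by (simp add: sign_compose permutation_swap_id sign_swap_id)
  have p: "permutation c" "permutation (pair_at (Suc k) m)"
    using c step.IH permutes_imp_permutation[OF finite_lessThan] by blast+
  show ?case
    unfolding eq sign_compose[OF p] using step.IH s permutes_compose[OF _ c] by (metis mult_1)
qed

text \<open>
A summand of the Pfaffian depends only on the perfect matching
\<open>{\<sigma> (2 * i), \<sigma> (2 * i + 1)}\<close>: exchanging the two ends of an edge changes both the sign of
the permutation and the sign of one entry, and the next lemma exchanges two edges.
\<close>

lemma pfaffian_term_swap_within_pair:
  assumes anti: "\<And>i j. A j i = - A i j" and \<sigma>: "permutation \<sigma>" and i: "i < n"
  shows "pfaffian_term A n (\<sigma> \<circ> Transposition.transpose (2 * i) (2 * i + 1)) = pfaffian_term A n \<sigma>"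
proof -
  let ?t = "Transposition.transpose (2 * i) (2 * i + 1)"
  have rest: "A ((\<sigma> \<circ> ?t) (2 * j)) ((\<sigma> \<circ> ?t) (2 * j + 1)) = A (\<sigma> (2 * j)) (\<sigma> (2 * j + 1))"
    if "j \<noteq> i" for j
  proof -
    have "2 * j \<noteq> 2 * i" "2 * j \<noteq> 2 * i + 1" "2 * j + 1 \<noteq> 2 * i" "2 * j + 1 \<noteq> 2 * i + 1"
      using that by presburger+
    then have "?t (2 * j) = 2 * j" "?t (2 * j + 1) = 2 * j + 1"
      unfolding Transposition.transpose_def by (simp_all only: if_False)
    then show ?thesis by simp
  qed
  have "(\<Prod>j<n. A ((\<sigma> \<circ> ?t) (2 * j)) ((\<sigma> \<circ> ?t) (2 * j + 1)))
      = A (\<sigma> (2 * i + 1)) (\<sigma> (2 * i)) * (\<Prod>j\<in>{..<n} - {i}. A (\<sigma> (2 * j)) (\<sigma> (2 * j + 1)))"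
    using i rest by (subst prod.remove[of _ i]) (auto intro!: prod.cong)
  also have "\<dots> = - (\<Prod>j<n. A (\<sigma> (2 * j)) (\<sigma> (2 * j + 1)))"
    using i by (subst prod.remove[of _ i]) (simp_all add: anti[of "\<sigma> (2 * i)" "\<sigma> (Suc (2 * i))"])
  finally show ?thesis
    unfolding pfaffian_term_def
    by (simp add: sign_compose[OF \<sigma> permutation_swap_id] sign_swap_id)
qed

lemma pfaffian_term_swap_pairs:
  assumes \<sigma>: "permutation \<sigma>" and i: "i < n" and j: "j < n"
  shows "pfaffian_term A n (\<sigma> \<circ> (Transposition.transpose (2 * i) (2 * j) \<circ> Transposition.transpose (2 * i + 1) (2 * j + 1)))
    = pfaffian_term A n \<sigma>"
proof -
  let ?t = "Transposition.transpose (2 * i) (2 * j) \<circ> Transposition.transpose (2 * i + 1) (2 * j + 1)"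
  have s: "sign (\<sigma> \<circ> ?t) = sign \<sigma>"
    by (simp add: sign_compose \<sigma> permutation_swap_id permutation_compose sign_swap_id)
  have ev: "?t (2 * l) = 2 * Transposition.transpose i j l" and od: "?t (2 * l + 1) = 2 * Transposition.transpose i j l + 1" for l
    by (auto simp: Transposition.transpose_def)
  have "(\<Prod>l<n. A ((\<sigma> \<circ> ?t) (2 * l)) ((\<sigma> \<circ> ?t) (2 * l + 1)))
      = (\<Prod>l<n. A (\<sigma> (2 * Transposition.transpose i j l)) (\<sigma> (2 * Transposition.transpose i j l + 1)))"
    using ev od by (metis comp_apply)
  also have "\<dots> = (\<Prod>l<n. A (\<sigma> (2 * l)) (\<sigma> (2 * l + 1)))"
    using permutes_swap_id[of i "{..<n}" j] i j
    by (intro prod.reindex_bij_betw permutes_imp_bij) auto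
  finally show ?thesis
    unfolding pfaffian_term_def s by simp
qed

text \<open>
If \<open>k\<close> and \<open>l\<close> are not matched with each other, each is matched with a row that does not
distinguish them. Exchanging them keeps the product and reverses the sign, so that such
summands cancel in pairs.
\<close>

lemma pfaffian_term_swap_equal_rows:
  assumes \<sigma>: "\<sigma> permutes {..<2 * n}" and kl: "k \<noteq> l" 
    and anti: "\<And>i j. A j i = - A i j"
    and eq: "\<And>j. j \<noteq> k \<Longrightarrow> j \<noteq> l \<Longrightarrow> j < 2 * n \<Longrightarrow> A j k = A j l"
    and unmatched: "\<And>i. i < n \<Longrightarrow> {\<sigma> (2 * i), \<sigma> (2 * i + 1)} \<noteq> {k, l}"
  shows "pfaffian_term A n (Transposition.transpose k l \<circ> \<sigma>) = - pfaffian_term A n \<sigma>"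
proof -
  let ?t = "Transposition.transpose k l"
  have perm: "permutation \<sigma>" using \<sigma> permutes_imp_permutation by blast
  have "A (?t (\<sigma> (2 * i))) (?t (\<sigma> (2 * i + 1))) = A (\<sigma> (2 * i)) (\<sigma> (2 * i + 1))" if "i < n" for i
  proof -
    define x y where "x = \<sigma> (2 * i)" and "y = \<sigma> (2 * i + 1)"
    have "x \<noteq> y"
      unfolding x_def y_def inj_eq[OF permutes_inj[OF \<sigma>]] by simp
    moreover have "x < 2 * n" "y < 2 * n"
      using permutes_in_image[OF \<sigma>, of "2 * i"] permutes_in_image[OF \<sigma>, of "2 * i + 1"] that
      by (simp_all add: x_def y_def)
    moreover have "{x, y} \<noteq> {k, l}"
      using unmatched[OF that] by (simp add: x_def y_def)
    ultimately have xy: "x \<noteq> y" "x < 2 * n" "y < 2 * n" "{x, y} \<noteq> {k, l}" by auto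
    have eq': "A k j = A l j" if "j \<noteq> k" "j \<noteq> l" "j < 2 * n" for j
      using eq[OF that] anti[of j k] anti[of j l] by simp
    have "A (?t x) (?t y) = A x y"
      using xy eq[of x] eq'[of y] kl by (auto simp: Transposition.transpose_def)
    then show ?thesis by (simp add: x_def y_def)
  qed
  then have "(\<Prod>i<n. A ((?t \<circ> \<sigma>) (2 * i)) ((?t \<circ> \<sigma>) (2 * i + 1)))
      = (\<Prod>i<n. A (\<sigma> (2 * i)) (\<sigma> (2 * i + 1)))"
    by simp
  then show ?thesis
    unfolding pfaffian_term_def
    using kl by (simp add: sign_compose[OF permutation_swap_id perm] sign_swap_id)
qed

text \<open>
Only matchings with the edge \<open>{k, k + 1}\<close> survive the cancellation. This edge can be listed at
each of \<open>n + 1\<close> places and in two orientations, with equal contributions; the factor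
\<open>2 * (n + 1)\<close> is the ratio of the two normalizations. When the edge is listed last, the rest is a
summand for the deleted matrix, with the same sign because \<^const>\<open>pair_at\<close> is even.
\<close>

lemma pfaffian_delete_equal_rows:
  assumes anti: "\<And>i j. A j i = - A i j"
    and k: "k \<le> 2 * n"
    and one: "A k (Suc k) = 1"
    and eq: "\<And>j. j \<noteq> k \<Longrightarrow> j \<noteq> Suc k \<Longrightarrow> j < 2 * Suc n \<Longrightarrow> A j k = A j (Suc k)"
  shows "pfaffian (Suc n) A = pfaffian n (\<lambda>i j. A (pair_at k (2 * n) i) (pair_at k (2 * n) j))"
proof -
  define U where "U = {\<sigma>. \<sigma> permutes {..<2 * Suc n}}"
  define f where "f = pfaffian_term A (Suc n)"
  have finU: "finite U" unfolding U_def by (simp add: finite_permutations)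
  have permU: "permutation \<sigma>" if "\<sigma> \<in> U" for \<sigma>
    using that permutes_imp_permutation unfolding U_def by blast
  have right: "sum g U = (\<Sum>\<sigma>\<in>U. g (\<sigma> \<circ> q))" if "q permutes {..<2 * Suc n}" for g :: "_ \<Rightarrow> real" and q
    unfolding U_def by (rule sum_permutations_compose_right[OF that])
  have left: "sum g U = (\<Sum>\<sigma>\<in>U. g (q \<circ> \<sigma>))" if "q permutes {..<2 * Suc n}" for g :: "_ \<Rightarrow> real" and q
    unfolding U_def by (rule setum_permutations_compose_left[OF that])
  \<comment> \<open>Split according to the partner of \<open>k\<close>: \<open>k + 1\<close> at place \<open>i\<close>, in either orientation, or not \<open>k + 1\<close>.\<close>
  define matched where
    "matched = (\<lambda>\<sigma> (i :: nat). \<sigma> (2 * i) = k \<and> \<sigma> (2 * i + 1) = Suc k)"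
  define rev_matched where
    "rev_matched = (\<lambda>\<sigma> (i :: nat). \<sigma> (2 * i) = Suc k \<and> \<sigma> (2 * i + 1) = k)"
  define free where "free = (\<lambda>\<sigma>. \<forall>i<Suc n. \<not> matched \<sigma> i \<and> \<not> rev_matched \<sigma> i)"
  define Q where "Q = (\<Sum>\<sigma>\<in>U. if matched \<sigma> n then f \<sigma> else 0)"

  \<comment> \<open>Exchanging \<open>k\<close> and \<open>k + 1\<close> shows that the sum over \<open>free\<close> permutations is its own negative.\<close>
  have tk: "Transposition.transpose k (Suc k) permutes {..<2 * Suc n}"
    using k by (intro permutes_swap_id) auto
  have "(\<Sum>\<sigma>\<in>U. if free \<sigma> then f \<sigma> else 0)
      = (\<Sum>\<sigma>\<in>U. if free (Transposition.transpose k (Suc k) \<circ> \<sigma>) then f (Transposition.transpose k (Suc k) \<circ> \<sigma>) else 0)"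
    by (rule left[OF tk])
  also have "\<dots> = (\<Sum>\<sigma>\<in>U. - (if free \<sigma> then f \<sigma> else 0))"
  proof (rule sum.cong[OF refl])
    fix \<sigma> assume \<sigma>: "\<sigma> \<in> U"
    have "free (Transposition.transpose k (Suc k) \<circ> \<sigma>) = free \<sigma>"
      unfolding free_def matched_def rev_matched_def by (auto simp: transpose_eq_iff)
    moreover have "f (Transposition.transpose k (Suc k) \<circ> \<sigma>) = - f \<sigma>" if "free \<sigma>"
      unfolding f_def
    proof (rule pfaffian_term_swap_equal_rows)
      show "\<sigma> permutes {..<2 * Suc n}" using \<sigma> by (simp add: U_def)
      show "{\<sigma> (2 * i), \<sigma> (2 * i + 1)} \<noteq> {k, Suc k}" if "i < Suc n" for i
        using \<open>free \<sigma>\<close> that unfolding free_def matched_def rev_matched_def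
        by (auto simp: doubleton_eq_iff)
      show "A j i = - A i j" for i j by (rule anti)
      show "A j k = A j (Suc k)" if "j \<noteq> k" "j \<noteq> Suc k" "j < 2 * Suc n" for j
        using that by (rule eq)
    qed simp
    ultimately show "(if free (Transposition.transpose k (Suc k) \<circ> \<sigma>) then f (Transposition.transpose k (Suc k) \<circ> \<sigma>) else 0)
        = - (if free \<sigma> then f \<sigma> else 0)" by simp
  qed
  finally have unmatched_sum: "(\<Sum>\<sigma>\<in>U. if free \<sigma> then f \<sigma> else 0) = 0"
    by (simp add: sum_negf)

  \<comment> \<open>All places and both orientations contribute the same amount \<open>Q\<close>.\<close>
  have matched_sum: "(\<Sum>\<sigma>\<in>U. if matched \<sigma> i then f \<sigma> else 0) = Q" if i: "i < Suc n" for i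
  proof -
    let ?q = "Transposition.transpose (2 * i) (2 * n) \<circ> Transposition.transpose (2 * i + 1) (2 * n + 1)"
    have q: "?q permutes {..<2 * Suc n}"
      using i by (intro permutes_compose permutes_swap_id) auto
    have m: "matched (\<sigma> \<circ> ?q) i = matched \<sigma> n" for \<sigma>
      unfolding matched_def using i by (auto simp: Transposition.transpose_def)
    have "f (\<sigma> \<circ> ?q) = f \<sigma>" if "\<sigma> \<in> U" for \<sigma>
      unfolding f_def using pfaffian_term_swap_pairs[OF permU[OF that] i, of n] by simp
    then have "(\<Sum>\<sigma>\<in>U. if matched (\<sigma> \<circ> ?q) i then f (\<sigma> \<circ> ?q) else 0) = Q"
      unfolding Q_def m by (intro sum.cong) auto
    then show ?thesis by (subst right[OF q])
  qed
  have rev_matched_sum: "(\<Sum>\<sigma>\<in>U. if rev_matched \<sigma> i then f \<sigma> else 0) = Q" if i: "i < Suc n" for i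
  proof -
    let ?q = "Transposition.transpose (2 * i) (2 * i + 1)"
    have q: "?q permutes {..<2 * Suc n}"
      using i by (intro permutes_swap_id) auto
    have m: "rev_matched (\<sigma> \<circ> ?q) i = matched \<sigma> i" for \<sigma>
      unfolding matched_def rev_matched_def by auto
    have "f (\<sigma> \<circ> ?q) = f \<sigma>" if "\<sigma> \<in> U" for \<sigma>
      unfolding f_def using pfaffian_term_swap_within_pair[OF anti permU[OF that] i] by simp
    then have "(\<Sum>\<sigma>\<in>U. if rev_matched (\<sigma> \<circ> ?q) i then f (\<sigma> \<circ> ?q) else 0)
        = (\<Sum>\<sigma>\<in>U. if matched \<sigma> i then f \<sigma> else 0)"
      unfolding m by (intro sum.cong) auto
    then show ?thesis using matched_sum[OF i] by (subst right[OF q]) simp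
  qed

  have split: "f \<sigma> = (if free \<sigma> then f \<sigma> else 0) + (\<Sum>i<Suc n.
      (if matched \<sigma> i then f \<sigma> else 0) + (if rev_matched \<sigma> i then f \<sigma> else 0))" if \<sigma>: "\<sigma> \<in> U" for \<sigma>
  proof (cases "free \<sigma>")
    case True
    then show ?thesis by (simp add: free_def)
  next
    case False
    then obtain i where i: "i < Suc n" "matched \<sigma> i \<or> rev_matched \<sigma> i"
      unfolding free_def by blast
    have inj: "\<sigma> x = \<sigma> y \<longleftrightarrow> x = y" for x y
      using \<sigma> inj_eq[OF permutes_inj, of \<sigma>] unfolding U_def by blast
    have other: "\<not> matched \<sigma> j \<and> \<not> rev_matched \<sigma> j" if "j \<noteq> i" for j
    proof -
      have "\<sigma> (2 * j) \<noteq> \<sigma> (2 * i)" "\<sigma> (2 * j) \<noteq> \<sigma> (2 * i + 1)"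
        unfolding inj using that by presburger+
      then show ?thesis using i(2) unfolding matched_def rev_matched_def by metis
    qed
    have one_way: "\<not> (matched \<sigma> i \<and> rev_matched \<sigma> i)"
      unfolding matched_def rev_matched_def by auto
    have "(\<Sum>j<Suc n. (if matched \<sigma> j then f \<sigma> else 0) + (if rev_matched \<sigma> j then f \<sigma> else 0))
        = (\<Sum>j<Suc n. if j = i then f \<sigma> else 0)"
      using other i(2) one_way by (intro sum.cong) auto
    also have "\<dots> = f \<sigma>" using i(1) by simp
    finally show ?thesis using False by simp
  qed
  have "sum f U = (\<Sum>\<sigma>\<in>U. (if free \<sigma> then f \<sigma> else 0) + (\<Sum>i<Suc n.
      (if matched \<sigma> i then f \<sigma> else 0) + (if rev_matched \<sigma> i then f \<sigma> else 0)))"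
    using split by (rule sum.cong[OF refl])
  also have "\<dots> = (\<Sum>i<Suc n. (\<Sum>\<sigma>\<in>U. if matched \<sigma> i then f \<sigma> else 0)
      + (\<Sum>\<sigma>\<in>U. if rev_matched \<sigma> i then f \<sigma> else 0))"
    unfolding sum.distrib unmatched_sum
    by (simp add: sum.swap[of _ U] sum.distrib del: sum.lessThan_Suc)
  also have "\<dots> = (\<Sum>i<Suc n. 2 * Q)"
    using matched_sum rev_matched_sum by (intro sum.cong) auto
  finally have total: "sum f U = 2 * real (Suc n) * Q" by simp

  \<comment> \<open>Composing with \<open>?\<tau>\<close>, which maps \<open>2 * n, 2 * n + 1\<close> to \<open>k, k + 1\<close>, leaves the permutations of the first \<open>2 * n\<close>.\<close>
  let ?\<tau> = "pair_at k (2 * n)"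
  have \<tau>: "?\<tau> permutes {..<2 * Suc n}" and \<tau>_sign: "sign ?\<tau> = 1"
    using pair_at_even_permutation[OF k] by auto
  have \<tau>_perm: "permutation ?\<tau>" using \<tau> permutes_imp_permutation by blast
  let ?ends_fixed = "\<lambda>\<sigma>. \<sigma> (2 * n) = 2 * n \<and> \<sigma> (2 * n + 1) = 2 * n + 1"
  have \<tau>_end: "?\<tau> x = k \<longleftrightarrow> x = 2 * n" "?\<tau> x = Suc k \<longleftrightarrow> x = 2 * n + 1" for x
    using k by (auto simp: pair_at_def split: if_splits)
  have "Q = (\<Sum>\<sigma>\<in>U. if matched (?\<tau> \<circ> \<sigma>) n then f (?\<tau> \<circ> \<sigma>) else 0)"
    unfolding Q_def by (rule left[OF \<tau>])
  also have "\<dots> = (\<Sum>\<sigma>\<in>U. if ?ends_fixed \<sigma> then f (?\<tau> \<circ> \<sigma>) else 0)"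
    by (simp add: matched_def \<tau>_end)
  also have "\<dots> = (\<Sum>\<sigma>\<in>{\<sigma>\<in>U. ?ends_fixed \<sigma>}. f (?\<tau> \<circ> \<sigma>))"
    by (rule sum.inter_filter[OF finU, symmetric])
  also have "{\<sigma>\<in>U. ?ends_fixed \<sigma>} = {\<sigma>. \<sigma> permutes {..<2 * n}}"
  proof (intro equalityI subsetI CollectI)
    fix \<sigma> assume "\<sigma> \<in> {\<sigma>\<in>U. ?ends_fixed \<sigma>}"
    then have p: "\<sigma> permutes {..<2 * Suc n}" "?ends_fixed \<sigma>" by (auto simp: U_def)
    show "\<sigma> permutes {..<2 * n}"
    proof (rule permutes_superset[OF p(1)])
      fix x assume "x \<in> {..<2 * Suc n} - {..<2 * n}"
      then have "x = 2 * n \<or> x = 2 * n + 1" by auto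
      then show "\<sigma> x = x" using p(2) by blast
    qed
  next
    fix \<sigma> assume "\<sigma> \<in> {\<sigma>. \<sigma> permutes {..<2 * n}}"
    then have p: "\<sigma> permutes {..<2 * n}" by simp
    have "\<sigma> permutes {..<2 * Suc n}" by (rule permutes_subset[OF p]) auto
    then show "\<sigma> \<in> U \<and> ?ends_fixed \<sigma>"
      using permutes_not_in[OF p, of "2 * n"] permutes_not_in[OF p, of "2 * n + 1"] by (simp add: U_def)
  qed
  also have "(\<Sum>\<sigma>\<in>{\<sigma>. \<sigma> permutes {..<2 * n}}. f (?\<tau> \<circ> \<sigma>))
      = (\<Sum>\<sigma> | \<sigma> permutes {..<2 * n}. pfaffian_term (\<lambda>i j. A (?\<tau> i) (?\<tau> j)) n \<sigma>)"
  proof (rule sum.cong[OF refl])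
    fix \<sigma> assume "\<sigma> \<in> {\<sigma>. \<sigma> permutes {..<2 * n}}"
    then have p: "\<sigma> permutes {..<2 * n}" by simp
    have perm: "permutation \<sigma>" using p permutes_imp_permutation by blast
    have end_values: "\<sigma> (2 * n) = 2 * n" "\<sigma> (Suc (2 * n)) = Suc (2 * n)"
      using permutes_not_in[OF p, of "2 * n"] permutes_not_in[OF p, of "2 * n + 1"] by simp_all
    have "?\<tau> (2 * n) = k" "?\<tau> (Suc (2 * n)) = Suc k" using \<tau>_end by auto
    then show "f (?\<tau> \<circ> \<sigma>) = pfaffian_term (\<lambda>i j. A (?\<tau> i) (?\<tau> j)) n \<sigma>"
      unfolding f_def pfaffian_term_def using end_values one
      by (simp add: sign_compose[OF \<tau>_perm perm] \<tau>_sign)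
  qed
  finally have Q: "Q = (\<Sum>\<sigma> | \<sigma> permutes {..<2 * n}. pfaffian_term (\<lambda>i j. A (?\<tau> i) (?\<tau> j)) n \<sigma>)" .
  have "pfaffian (Suc n) A = sum f U / (2 ^ Suc n * fact (Suc n))"
    unfolding pfaffian_def f_def U_def pfaffian_term_def ..
  also have "\<dots> = Q / (2 ^ n * fact n)"
    unfolding total fact_Suc power_Suc by (simp add: divide_simps del: of_nat_Suc)
  also have "\<dots> = pfaffian n (\<lambda>i j. A (?\<tau> i) (?\<tau> j))"
    unfolding pfaffian_def Q pfaffian_term_def ..
  finally show ?thesis .
qed

section \<open>Pfaffians with independent random entries\<close>

lemma prod_lessThan_double: "(\<Prod>k<2 * n. f k) = (\<Prod>i<n. f (2 * i) * f (2 * i + 1))"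
  for f :: "nat \<Rightarrow> real"
  by (induction n) (auto simp: mult.assoc)

text \<open>
Grouping the choices according to the pairs \<open>{\<sigma> (2 * i), \<sigma> (2 * i + 1)}\<close> turns the sum over
\<open>2 * n\<close> choices into a sum over \<open>n\<close> pairs of choices, which factorizes.
\<close>

lemma sum_prod_over_pairs:
  fixes w :: "nat \<Rightarrow> bool \<Rightarrow> real" and X :: "nat \<Rightarrow> nat \<Rightarrow> bool \<Rightarrow> bool \<Rightarrow> real"
  assumes \<sigma>: "\<sigma> permutes {..<2 * n}"
  shows "(\<Sum>c\<in>PiE {..<2 * n} (\<lambda>_. UNIV). (\<Prod>k<2 * n. w k (c k)) *
      (\<Prod>i<n. X (\<sigma> (2 * i)) (\<sigma> (2 * i + 1)) (c (\<sigma> (2 * i))) (c (\<sigma> (2 * i + 1)))))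
    = (\<Prod>i<n. \<Sum>e\<in>UNIV. \<Sum>e'\<in>UNIV. w (\<sigma> (2 * i)) e * w (\<sigma> (2 * i + 1)) e' *
        X (\<sigma> (2 * i)) (\<sigma> (2 * i + 1)) e e')" (is "?L = ?R")
proof -
  let ?C = "PiE {..<2 * n} (\<lambda>_. UNIV :: bool set)"
  let ?D = "PiE {..<n} (\<lambda>_. UNIV :: (bool \<times> bool) set)"
  define h where "h = (\<lambda>i (e, e'). w (\<sigma> (2 * i)) e * w (\<sigma> (2 * i + 1)) e' *
        X (\<sigma> (2 * i)) (\<sigma> (2 * i + 1)) e e')"
  have img: "\<sigma> k < 2 * n \<longleftrightarrow> k < 2 * n" for k
    using permutes_in_image[OF \<sigma>, of k] by simp
  have inv_img: "inv \<sigma> k < 2 * n \<longleftrightarrow> k < 2 * n" for k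
    using permutes_in_image[OF permutes_inv[OF \<sigma>], of k] by simp
  have inv: "inv \<sigma> (\<sigma> k) = k" "\<sigma> (inv \<sigma> k) = k" for k
    using permutes_inverses[OF \<sigma>] by auto
  have "?L = (\<Sum>c\<in>?C. \<Prod>i<n. h i (c (\<sigma> (2 * i)), c (\<sigma> (2 * i + 1))))"
  proof (rule sum.cong[OF refl])
    fix c
    have "(\<Prod>k<2 * n. w k (c k)) = (\<Prod>k<2 * n. w (\<sigma> k) (c (\<sigma> k)))"
      by (rule prod.reindex_bij_betw[OF permutes_imp_bij[OF \<sigma>], symmetric])
    also have "\<dots> = (\<Prod>i<n. w (\<sigma> (2 * i)) (c (\<sigma> (2 * i))) * w (\<sigma> (2 * i + 1)) (c (\<sigma> (2 * i + 1))))"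
      by (rule prod_lessThan_double)
    finally show "(\<Prod>k<2 * n. w k (c k)) *
      (\<Prod>i<n. X (\<sigma> (2 * i)) (\<sigma> (2 * i + 1)) (c (\<sigma> (2 * i))) (c (\<sigma> (2 * i + 1))))
      = (\<Prod>i<n. h i (c (\<sigma> (2 * i)), c (\<sigma> (2 * i + 1))))"
      by (simp add: h_def prod.distrib)
  qed
  \<comment> \<open>Index \<open>k\<close> belongs to pair number \<open>inv \<sigma> k div 2\<close>; the parity of \<open>inv \<sigma> k\<close> says at which end.\<close>
  also have "\<dots> = (\<Sum>d\<in>?D. \<Prod>i<n. h i (d i))"
  proof (rule sum.reindex_bij_witness)
    let ?from = "\<lambda>d. \<lambda>k\<in>{..<2 * n}.
      (if even (inv \<sigma> k) then fst (d (inv \<sigma> k div 2)) else snd (d (inv \<sigma> k div 2)))"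
    let ?to = "\<lambda>c. \<lambda>i\<in>{..<n}. (c (\<sigma> (2 * i)), c (\<sigma> (2 * i + 1)))"
    fix c assume c: "c \<in> ?C"
    show "?from (?to c) = c"
    proof
      fix k
      show "?from (?to c) k = c k"
      proof (cases "k < 2 * n")
        case True
        then have m: "inv \<sigma> k < 2 * n" by (simp add: inv_img)
        then have d: "inv \<sigma> k div 2 < n" by auto
        show ?thesis
        proof (cases "even (inv \<sigma> k)")
          case True
          then have "2 * (inv \<sigma> k div 2) = inv \<sigma> k" by simp
          then show ?thesis using True \<open>k < 2 * n\<close> d by (simp add: inv)
        next
          case False
          then have "Suc (2 * (inv \<sigma> k div 2)) = inv \<sigma> k" by simp
          then show ?thesis using False \<open>k < 2 * n\<close> d by (simp add: inv)
        qed
      next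
        case False
        then show ?thesis using c by (auto simp: PiE_def extensional_def)
      qed
    qed
    show "?to c \<in> ?D" by auto
    show "(\<Prod>i<n. h i (?to c i)) = (\<Prod>i<n. h i (c (\<sigma> (2 * i)), c (\<sigma> (2 * i + 1))))"
      by simp
  next
    let ?from = "\<lambda>d. \<lambda>k\<in>{..<2 * n}.
      (if even (inv \<sigma> k) then fst (d (inv \<sigma> k div 2)) else snd (d (inv \<sigma> k div 2)))"
    let ?to = "\<lambda>c. \<lambda>i\<in>{..<n}. (c (\<sigma> (2 * i)), c (\<sigma> (2 * i + 1)))"
    fix d assume d: "d \<in> ?D"
    show "?to (?from d) = d"
    proof
      fix i
      show "?to (?from d) i = d i"
      proof (cases "i < n")
        case True
        then show ?thesis using img[of "2 * i"] img[of "Suc (2 * i)"] by (simp add: inv)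
      next
        case False
        then show ?thesis using d by (auto simp: PiE_def extensional_def)
      qed
    qed
    show "?from d \<in> ?C" by auto
  qed
  also have "\<dots> = (\<Prod>i<n. \<Sum>x\<in>UNIV. h i x)"
    by (rule prod_sum_PiE[symmetric]) auto
  also have "\<dots> = ?R"
    by (simp add: h_def UNIV_Times_UNIV[symmetric] sum.cartesian_product del: UNIV_Times_UNIV UNIV_bool)
  finally show ?thesis .
qed

text \<open>
Every summand of the Pfaffian uses each index exactly once, in a single entry. Entry \<open>(k, l)\<close>
depends on the independent choices number \<open>k\<close> and \<open>l\<close> only, hence the entries in one summand
are independent and the expectation may be taken entrywise.
\<close>

lemma pfaffian_expectation:
  fixes w :: "nat \<Rightarrow> bool \<Rightarrow> real" and X :: "nat \<Rightarrow> nat \<Rightarrow> bool \<Rightarrow> bool \<Rightarrow> real"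
  shows "(\<Sum>c\<in>PiE {..<2 * n} (\<lambda>_. UNIV). (\<Prod>k<2 * n. w k (c k)) *
      pfaffian n (\<lambda>k l. X k l (c k) (c l)))
    = pfaffian n (\<lambda>k l. \<Sum>e\<in>UNIV. \<Sum>e'\<in>UNIV. w k e * w l e' * X k l e e')"
proof -
  let ?S = "{\<sigma>. \<sigma> permutes {..<2 * n}}" and ?C = "PiE {..<2 * n} (\<lambda>_. UNIV :: bool set)"
  have "(\<Sum>c\<in>?C. (\<Prod>k<2 * n. w k (c k)) * pfaffian n (\<lambda>k l. X k l (c k) (c l)))
    = (\<Sum>c\<in>?C. \<Sum>\<sigma>\<in>?S. real_of_int (sign \<sigma>) * ((\<Prod>k<2 * n. w k (c k)) *
        (\<Prod>i<n. X (\<sigma> (2 * i)) (\<sigma> (2 * i + 1)) (c (\<sigma> (2 * i))) (c (\<sigma> (2 * i + 1)))))) / (2 ^ n * fact n)"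
    unfolding pfaffian_def
    by (simp add: sum_distrib_left sum_divide_distrib mult.left_commute)
  also have "\<dots> = (\<Sum>\<sigma>\<in>?S. real_of_int (sign \<sigma>) * (\<Sum>c\<in>?C. (\<Prod>k<2 * n. w k (c k)) *
        (\<Prod>i<n. X (\<sigma> (2 * i)) (\<sigma> (2 * i + 1)) (c (\<sigma> (2 * i))) (c (\<sigma> (2 * i + 1)))))) / (2 ^ n * fact n)"
    by (subst sum.swap) (simp add: sum_distrib_left)
  also have "\<dots> = pfaffian n (\<lambda>k l. \<Sum>e\<in>UNIV. \<Sum>e'\<in>UNIV. w k e * w l e' * X k l e e')"
    unfolding pfaffian_def
    by (intro arg_cong2[where f="(/)"] refl sum.cong arg_cong2[where f="(*)"] sum_prod_over_pairs) simp
  finally show ?thesis .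
qed

section \<open>Independence of the choices\<close>

lemma prob_space_checkerboard: "prob_space (checkerboard p)"
  unfolding checkerboard_def by (intro prob_space_PiM measure_pmf.prob_space_axioms)

lemma space_checkerboard [simp]: "space (checkerboard p) = UNIV"
  by (simp add: checkerboard_def space_PiM)

lemma measurable_choice [measurable]:
  "(\<lambda>\<omega>. \<omega> z) \<in> measurable (checkerboard p) (count_space UNIV)"
proof -
  have "(\<lambda>\<omega>. \<omega> z) \<in> measurable (checkerboard p) (measure_pmf (bernoulli_pmf (p z)))"
    unfolding checkerboard_def by (rule measurable_component_singleton) simp
  then show ?thesis by simp
qed

text \<open>
The product measure splits off the factor at \<open>z\<close>, and the event is a rectangle for this
splitting, because \<open>E\<close> does not look at \<open>z\<close>.
\<close>

lemma prob_fix_coordinate: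
  assumes E: "{\<omega>. E \<omega>} \<in> sets (checkerboard p)"
    and indep: "\<And>\<omega> c. E (\<omega> (z := c)) = E \<omega>"
  shows "measure (checkerboard p) {\<omega>. \<omega> z = c \<and> E \<omega>}
    = pmf (bernoulli_pmf (p z)) c * measure (checkerboard p) {\<omega>. E \<omega>}"
proof -
  let ?B = "\<lambda>z. measure_pmf (bernoulli_pmf (p z))"
  let ?N = "PiM (UNIV - {z}) ?B"
  let ?f = "\<lambda>(x, X). X(z := x)"
  interpret N: prob_space ?N
    by (intro prob_space_PiM measure_pmf.prob_space_axioms)
  have "distr (?B z \<Otimes>\<^sub>M ?N) (PiM (insert z (UNIV - {z})) ?B) ?f = PiM (insert z (UNIV - {z})) ?B"
    by (intro distr_pair_PiM_eq_PiM measure_pmf.prob_space_axioms)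
  then have M: "checkerboard p = distr (?B z \<Otimes>\<^sub>M ?N) (checkerboard p) ?f"
    by (simp add: checkerboard_def insert_absorb)
  have f: "?f \<in> measurable (?B z \<Otimes>\<^sub>M ?N) (checkerboard p)"
    unfolding checkerboard_def
    using measurable_comp[OF measurable_pair_swap' measurable_add_dim[of z "UNIV - {z}" ?B]]
    by (simp add: comp_def split_beta insert_absorb)
  \<comment> \<open>The section of \<open>E\<close>; the value \<open>True\<close> at \<open>z\<close> is arbitrary.\<close>
  define E' where "E' = {X \<in> space ?N. E (X(z := True))}"
  have "(\<lambda>X. X(z := True)) \<in> measurable ?N (checkerboard p)"
    using measurable_compose[OF measurable_Pair1' f, of True] by simp
  from measurable_sets[OF this E] have E': "E' \<in> sets ?N"
    by (simp add: E'_def vimage_def Int_def conj_commute)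
  \<comment> \<open>The case \<open>C = UNIV\<close> identifies the second factor as the probability of \<open>E\<close>.\<close>
  have *: "emeasure (checkerboard p) {\<omega>. \<omega> z \<in> C \<and> E \<omega>} = emeasure (?B z) C * emeasure ?N E'" for C
  proof -
    have "{\<omega>. \<omega> z \<in> C \<and> E \<omega>} = {\<omega> \<in> space (checkerboard p). \<omega> z \<in> C} \<inter> {\<omega>. E \<omega>}" by auto
    also have "\<dots> \<in> sets (checkerboard p)"
      by (rule sets.Int[OF _ E]) measurable
    finally have S: "{\<omega>. \<omega> z \<in> C \<and> E \<omega>} \<in> sets (checkerboard p)" .
    have "?f -` {\<omega>. \<omega> z \<in> C \<and> E \<omega>} \<inter> space (?B z \<Otimes>\<^sub>M ?N) = C \<times> E'"
      using indep by (auto simp: E'_def space_pair_measure)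
    moreover have "emeasure (checkerboard p) {\<omega>. \<omega> z \<in> C \<and> E \<omega>}
        = emeasure (?B z \<Otimes>\<^sub>M ?N) (?f -` {\<omega>. \<omega> z \<in> C \<and> E \<omega>} \<inter> space (?B z \<Otimes>\<^sub>M ?N))"
      using emeasure_distr[OF f S] M by simp
    ultimately show ?thesis
      using N.emeasure_pair_measure_Times[OF _ E', of C "?B z"] by simp
  qed
  have "emeasure (checkerboard p) {\<omega>. E \<omega>} = emeasure ?N E'"
    using *[of UNIV] measure_pmf.emeasure_space_1[of "bernoulli_pmf (p z)"] by simp
  then have "emeasure (checkerboard p) {\<omega>. \<omega> z = c \<and> E \<omega>}
      = emeasure (?B z) {c} * emeasure (checkerboard p) {\<omega>. E \<omega>}"
    using *[of "{c}"] by simp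
  then show ?thesis
    unfolding measure_def by (simp add: enn2real_mult emeasure_pmf_single)
qed

lemma prob_fix_coordinates:
  fixes m :: nat
  assumes E: "{\<omega>. E \<omega>} \<in> sets (checkerboard p)"
    and indep: "\<And>k \<omega> c. k < m \<Longrightarrow> E (\<omega> (z k := c)) = E \<omega>"
    and inj: "inj_on z {..<m}"
  shows "measure (checkerboard p) {\<omega>. (\<forall>k<m. \<omega> (z k) = c k) \<and> E \<omega>}
    = (\<Prod>k<m. pmf (bernoulli_pmf (p (z k))) (c k)) * measure (checkerboard p) {\<omega>. E \<omega>}"
  using indep inj
proof (induction m)
  case (Suc m)
  let ?F = "\<lambda>\<omega>. (\<forall>k<m. \<omega> (z k) = c k) \<and> E \<omega>"
  have "{\<omega>. ?F \<omega>} = {\<omega> \<in> space (checkerboard p). \<forall>k\<in>{..<m}. \<omega> (z k) = c k} \<inter> {\<omega>. E \<omega>}" by auto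
  also have "\<dots> \<in> sets (checkerboard p)"
    by (rule sets.Int[OF _ E]) measurable
  finally have F: "{\<omega>. ?F \<omega>} \<in> sets (checkerboard p)" .
  have z: "z k \<noteq> z m" if "k < m" for k
    using Suc.prems(2) that by (auto dest!: inj_onD[where x = k and y = m])
  have "measure (checkerboard p) {\<omega>. (\<forall>k<Suc m. \<omega> (z k) = c k) \<and> E \<omega>}
      = measure (checkerboard p) {\<omega>. \<omega> (z m) = c m \<and> ?F \<omega>}"
    by (rule arg_cong[where f = "measure _"]) (auto simp: less_Suc_eq)
  also have "\<dots> = pmf (bernoulli_pmf (p (z m))) (c m) * measure (checkerboard p) {\<omega>. ?F \<omega>}"
  proof (rule prob_fix_coordinate[OF F])
    fix \<omega> d
    have "E (\<omega> (z m := d)) = E \<omega>"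
      by (rule Suc.prems(1)) simp
    then show "?F (\<omega> (z m := d)) = ?F \<omega>"
      using z by auto
  qed
  also have "measure (checkerboard p) {\<omega>. ?F \<omega>}
      = (\<Prod>k<m. pmf (bernoulli_pmf (p (z k))) (c k)) * measure (checkerboard p) {\<omega>. E \<omega>}"
    using Suc.prems by (intro Suc.IH) (auto simp: inj_on_def)
  finally show ?case by (simp add: mult_ac)
qed simp

section \<open>Duality\<close>

text \<open>
The backward path in the environment \<open>\<omega>\<close>, in integer coordinates: the integer \<open>u\<close> at time
\<open>t\<close> encodes the dual vertex \<open>(u + 1/2, t - u - 1/2)\<close>. Its next choice is made at
\<open>(u, t - 1 - u)\<close>, and the value is the encoded end of the path at time \<open>0\<close>. Two such paths share
their randomness, so they coalesce when they meet.
\<close>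

primrec dual_end :: "(int \<times> int \<Rightarrow> bool) \<Rightarrow> nat \<Rightarrow> int \<Rightarrow> int" where
  "dual_end \<omega> 0 u = u"
| "dual_end \<omega> (Suc t) u = dual_end \<omega> t (u - of_bool (\<omega> (u, int t - u)))"

lemma dual_end_mono: "u \<le> w \<Longrightarrow> dual_end \<omega> t u \<le> dual_end \<omega> t w"
proof (induction t arbitrary: u w)
  case (Suc t)
  have "u - of_bool (\<omega> (u, int t - u)) \<le> w - of_bool (\<omega> (w, int t - w))"
    using Suc.prems by (cases "u = w") auto
  then show ?case by (simp add: Suc.IH)
qed simp

lemma dual_end_upd: "int t \<le> fst z + snd z \<Longrightarrow> dual_end (\<omega> (z := c)) t u = dual_end \<omega> t u"
proof (induction t arbitrary: u)
  case (Suc t)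
  then have "(u, int t - u) \<noteq> z" by auto
  then show ?case using Suc by simp
qed simp

lemma measurable_dual_end [measurable]:
  "(\<lambda>\<omega>. dual_end \<omega> t u) \<in> measurable (checkerboard p) (count_space UNIV)"
proof (induction t arbitrary: u)
  case (Suc t)
  have step: "(\<lambda>\<omega>. u - of_bool (\<omega> (u, int t - u)) :: int) \<in> measurable (checkerboard p) (count_space UNIV)"
    by (rule measurable_compose[OF measurable_choice]) simp
  show ?case
    using measurable_compose_countable[OF Suc.IH step] by simp
qed simp

lemma forward_particle_time:
  "fst ((forward_step \<omega> ^^ t) (m, - m)) + snd ((forward_step \<omega> ^^ t) (m, - m)) = int t"
proof (induction t)
  case (Suc t)
  have "fst (forward_step \<omega> z) + snd (forward_step \<omega> z) = fst z + snd z + 1" for z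
    by (cases z) (simp add: forward_step_def)
  then show ?case using Suc by simp
qed simp

text \<open>
Forward particles stay on their side of the dual path that starts at \<open>u + 1/2\<close>. The only
critical case in the induction is a particle at the site whose choice moves the dual path as
well: East puts the particle to the right of \<open>u + 1/2\<close> and continues the dual path to the left of
that site, North leaves the particle to the left of \<open>u + 1/2\<close> and continues the dual path to the
right of that site.
\<close>

lemma forward_left_iff_dual:
  "fst ((forward_step \<omega> ^^ t) (m, - m)) \<le> u \<longleftrightarrow> m \<le> dual_end \<omega> t u"
proof (induction t arbitrary: u)
  case (Suc t)
  define z where "z = (forward_step \<omega> ^^ t) (m, - m)"
  have z: "z = (fst z, int t - fst z)"
    using forward_particle_time[of t \<omega> m] by (simp add: z_def prod_eq_iff)
  have "fst (forward_step \<omega> z) = fst z + of_bool (\<omega> z)"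
    by (cases z) (simp add: forward_step_def)
  moreover have "\<omega> z = \<omega> (u, int t - u)" if "fst z = u"
    using z that by metis
  ultimately have "fst (forward_step \<omega> z) \<le> u \<longleftrightarrow> fst z \<le> u - of_bool (\<omega> (u, int t - u))"
    by (cases "fst z = u") (auto simp: of_bool_def)
  then show ?case using Suc.IH by (simp add: z_def)
qed simp

text \<open>
The integers between \<open>u + 1/2\<close> and \<open>w + 1/2\<close> are those in \<open>{u<..w}\<close>.
\<close>

definition gaps_free :: "int set \<Rightarrow> nat \<Rightarrow> (nat \<Rightarrow> int) \<Rightarrow> bool" where
  "gaps_free \<eta> n v \<longleftrightarrow> (\<forall>i<n. \<eta> \<inter> {v (2 * i)<..v (2 * i + 1)} = {})"

lemma no_wall_iff_dual:
  "walls \<eta> t \<omega> \<inter> {u<..w} = {} \<longleftrightarrow> \<eta> \<inter> {dual_end \<omega> t u<..dual_end \<omega> t w} = {}"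
proof -
  have "fst ((forward_step \<omega> ^^ t) (m, - m)) \<in> {u<..w} \<longleftrightarrow> m \<in> {dual_end \<omega> t u<..dual_end \<omega> t w}" for m
    using forward_left_iff_dual[of t \<omega> m u] forward_left_iff_dual[of t \<omega> m w] by (auto simp: not_le[symmetric])
  then show ?thesis unfolding walls_def by blast
qed

text \<open>
If no particle lies between \<open>v k\<close> and \<open>v (k + 1)\<close>, both points can be forgotten. For even \<open>k\<close>
they bound a gap whose condition holds; for odd \<open>k\<close> they separate two consecutive gaps,
which merge into one.
\<close>

lemma gaps_free_delete:
  assumes mono: "mono_on {..<2 * Suc n} v" and k: "k \<le> 2 * n"
    and empty: "\<eta> \<inter> {v k<..v (Suc k)} = {}"
  shows "gaps_free \<eta> (Suc n) v = gaps_free \<eta> n (\<lambda>j. v (pair_at k (2 * n) j))"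
proof -
  have le: "v i \<le> v j" if "i \<le> j" "j < 2 * Suc n" for i j
    using mono_onD[OF mono, of i j] that by auto
  let ?P = "\<lambda>i j. \<eta> \<inter> {v i<..v j} = {}"
  show ?thesis
  proof (cases "even k")
    case True
    then obtain m where m: "k = 2 * m" by auto
    have rhs: "?P (pair_at k (2 * n) (2 * i)) (pair_at k (2 * n) (2 * i + 1))
        \<longleftrightarrow> (if i < m then ?P (2 * i) (2 * i + 1) else ?P (2 * Suc i) (2 * Suc i + 1))" if "i < n" for i
      using that by (auto simp: pair_at_def m)
    have "(\<forall>i<Suc n. ?P (2 * i) (2 * i + 1)) \<longleftrightarrow>
      (\<forall>i<n. if i < m then ?P (2 * i) (2 * i + 1) else ?P (2 * Suc i) (2 * Suc i + 1))" (is "?L \<longleftrightarrow> ?R")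
    proof
      assume ?R
      show ?L
      proof (intro allI impI)
        fix i assume "i < Suc n"
        consider "i < m" | "i = m" | i' where "i = Suc i'" "m \<le> i'"
          by (metis less_Suc_eq_le linorder_neqE_nat lessE Suc_leI less_imp_Suc_add le_add1)
        then show "?P (2 * i) (2 * i + 1)"
        proof cases
          case 1
          then show ?thesis using spec[OF \<open>?R\<close>, of i] k m by simp
        next
          case 2
          then show ?thesis using empty m by simp
        next
          case 3
          then show ?thesis using spec[OF \<open>?R\<close>, of i'] \<open>i < Suc n\<close> by simp
        qed
      qed
    next
      assume ?L
      show ?R
      proof (intro allI impI)
        fix i assume "i < n"
        then show "if i < m then ?P (2 * i) (2 * i + 1) else ?P (2 * Suc i) (2 * Suc i + 1)"
          using spec[OF \<open>?L\<close>, of i] spec[OF \<open>?L\<close>, of "Suc i"] by simp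
      qed
    qed
    then show ?thesis unfolding gaps_free_def using rhs by simp
  next
    case False
    then obtain m where m: "k = 2 * m + 1" by (elim oddE)
    then have mn: "m < n" using k by auto
    have rhs: "?P (pair_at k (2 * n) (2 * i)) (pair_at k (2 * n) (2 * i + 1))
        \<longleftrightarrow> (if i < m then ?P (2 * i) (2 * i + 1) else if i = m then ?P (2 * m) (2 * m + 3)
          else ?P (2 * Suc i) (2 * Suc i + 1))" if "i < n" for i
      using that by (auto simp: pair_at_def m numeral_3_eq_3)
    have "v (2 * m) \<le> v (2 * m + 1)" "v (2 * m + 1) \<le> v (2 * m + 2)" "v (2 * m + 2) \<le> v (2 * m + 3)"
      using mn by (auto intro: le)
    then have "{v (2 * m)<..v (2 * m + 3)} = {v (2 * m)<..v (2 * m + 1)} \<union> {v k<..v (Suc k)}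
        \<union> {v (2 * m + 2)<..v (2 * m + 3)}"
      using m by auto
    then have merge: "?P (2 * m) (2 * m + 3) \<longleftrightarrow> ?P (2 * m) (2 * m + 1) \<and> ?P (2 * Suc m) (2 * Suc m + 1)"
      using empty by (simp add: Int_Un_distrib numeral_3_eq_3)
    have "(\<forall>i<Suc n. ?P (2 * i) (2 * i + 1)) \<longleftrightarrow>
      (\<forall>i<n. if i < m then ?P (2 * i) (2 * i + 1) else if i = m then ?P (2 * m) (2 * m + 3)
          else ?P (2 * Suc i) (2 * Suc i + 1))" (is "?L \<longleftrightarrow> ?R")
    proof
      assume ?R
      have at: "?P (2 * m) (2 * m + 3)" using spec[OF \<open>?R\<close>, of m] mn by simp
      show ?L
      proof (intro allI impI)
        fix i assume "i < Suc n"
        consider "i < m" | "i = m" | "i = Suc m" | i' where "i = Suc i'" "m < i'"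
          by (metis less_Suc_eq_le linorder_neqE_nat lessE Suc_leI less_imp_Suc_add le_add1 le_neq_implies_less)
        then show "?P (2 * i) (2 * i + 1)"
        proof cases
          case 1
          then show ?thesis using spec[OF \<open>?R\<close>, of i] mn by simp
        next
          case 2
          then show ?thesis using at merge by simp
        next
          case 3
          then show ?thesis using at merge by simp
        next
          case 4
          then show ?thesis using spec[OF \<open>?R\<close>, of i'] \<open>i < Suc n\<close> by simp
        qed
      qed
    next
      assume ?L
      then have "?P (2 * m) (2 * m + 3)"
        unfolding merge using mn by (metis less_SucI Suc_less_eq)
      moreover have "?P (2 * i) (2 * i + 1) \<and> ?P (2 * Suc i) (2 * Suc i + 1)" if "i < n" for i
        using \<open>?L\<close> that by (metis less_SucI Suc_less_eq)
      ultimately show ?R by auto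
    qed
    then show ?thesis unfolding gaps_free_def using rhs by simp
  qed
qed

section \<open>Recursion for a pair of independent backward particles\<close>

lemma backward_path_nonempty: "zs \<in> set_pmf (backward_path p t z) \<Longrightarrow> zs \<noteq> [] \<and> hd zs = z"
  by (induction t arbitrary: z zs) auto

lemma cross_or_meet_Cons:
  "cross_or_meet (z # zs) (w # ws) \<longleftrightarrow> fst w \<le> fst z \<or> cross_or_meet zs ws"
proof -
  have "(\<exists>s<Suc m. P s) \<longleftrightarrow> P 0 \<or> (\<exists>s<m. P (Suc s))" for P m
    using less_Suc_eq_0_disj by auto
  then show ?thesis unfolding cross_or_meet_def by auto
qed

text \<open>
The crossing is already visible at the starting vertices, at index \<open>0\<close> of the two lists.
\<close>

lemma pair_prob_meeting:
  assumes "y \<le> x"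
  shows "pair_prob p \<eta> t x y = 1"
proof -
  have "cross_or_meet zs ws" if "zs \<in> set_pmf (backward_path p t (x, real t - x))"
    "ws \<in> set_pmf (backward_path p t (y, real t - y))" for zs ws
    using backward_path_nonempty[OF that(1)] backward_path_nonempty[OF that(2)] assms
    by (cases zs; cases ws) (auto simp: cross_or_meet_Cons)
  then show ?thesis
    unfolding pair_prob_def by (subst measure_pmf.prob_eq_1) (auto simp: AE_measure_pmf_iff)
qed

lemma pair_prob_0:
  fixes u w :: int
  shows "pair_prob p \<eta> 0 (u + 1 / 2) (w + 1 / 2) = of_bool (\<eta> \<inter> {u<..w} = {})"
proof (cases "u < w")
  case True
  have "real_of_int ` \<eta> \<inter> {u + 1 / 2<..<w + 1 / 2} = {} \<longleftrightarrow> \<eta> \<inter> {u<..w} = {}"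
  proof -
    have "real_of_int m \<in> {u + 1 / 2<..<w + 1 / 2} \<longleftrightarrow> m \<in> {u<..w}" for m
      by auto
    then show ?thesis by blast
  qed
  then show ?thesis
    using True by (simp add: pair_prob_def pair_return_pmf1 cross_or_meet_def empty_between_ends_def
        measure_return_pmf indicator_def)
next
  case False
  then have "{u<..w} = {}" by auto
  then show ?thesis using False by (simp add: pair_prob_meeting)
qed

lemma measure_bind_bernoulli:
  "measure (measure_pmf (bind_pmf (bernoulli_pmf q) f)) S
    = (\<Sum>e\<in>UNIV. pmf (bernoulli_pmf q) e * measure (measure_pmf (f e)) S)"
proof -
  have "measure (measure_pmf (bind_pmf (bernoulli_pmf q) f)) S
      = measure_pmf.expectation (bernoulli_pmf q) (\<lambda>e. measure (measure_pmf (f e)) S)"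
    unfolding measure_pmf_bind
    by (rule measure_pmf.measure_bind[where N = "count_space UNIV"]) (auto simp: space_subprob_algebra intro: measure_pmf.subprob_space_axioms)
  also have "\<dots> = (\<Sum>e\<in>UNIV. pmf (bernoulli_pmf q) e *\<^sub>R measure (measure_pmf (f e)) S)"
    by (rule integral_measure_pmf) auto
  finally show ?thesis by simp
qed

text \<open>
Condition on the first step of both particles. The initial positions are distinct and in
order, so the event is decided by the remaining paths; particles that met in the first step have
probability 1 on the right-hand side as well.
\<close>

lemma pair_prob_Suc:
  fixes u w :: int
  assumes "u < w"
  shows "pair_prob p \<eta> (Suc t) (u + 1 / 2) (w + 1 / 2)
    = (\<Sum>e\<in>UNIV. \<Sum>e'\<in>UNIV. pmf (bernoulli_pmf (p (u, int t - u))) e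
        * pmf (bernoulli_pmf (p (w, int t - w))) e'
        * pair_prob p \<eta> t (of_int (u - of_bool e) + 1 / 2) (of_int (w - of_bool e') + 1 / 2))"
proof -
  let ?x = "real_of_int u + 1 / 2" and ?y = "real_of_int w + 1 / 2"
  let ?z = "(?x, real (Suc t) - ?x)" and ?w = "(?y, real (Suc t) - ?y)"
  let ?start = "\<lambda>(u::int) e. (real_of_int (u - of_bool e) + 1 / 2, real t - (real_of_int (u - of_bool e) + 1 / 2))"
  let ?S = "{(zs, ws). cross_or_meet zs ws \<or> (\<not> cross_or_meet zs ws \<and> empty_between_ends \<eta> zs ws)}"
  let ?pairs = "\<lambda>e e'. pair_pmf (backward_path p t (?start u e)) (backward_path p t (?start w e'))"
  have path: "backward_path p (Suc t) (real_of_int u + 1 / 2, real (Suc t) - (real_of_int u + 1 / 2))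
      = bind_pmf (bernoulli_pmf (p (u, int t - u))) (\<lambda>e. map_pmf ((#) (real_of_int u + 1 / 2,
          real (Suc t) - (real_of_int u + 1 / 2))) (backward_path p t (?start u e)))" for u :: int
  proof -
    have fl: "\<lfloor>real_of_int u + 1 / 2\<rfloor> = u" "\<lfloor>real (Suc t) - (real_of_int u + 1 / 2)\<rfloor> = int t - u"
      by (simp_all add: floor_eq_iff)
    have "backward_edge e (real_of_int u + 1 / 2, real (Suc t) - (real_of_int u + 1 / 2)) = ?start u e" for e
      by simp
    then show ?thesis
      unfolding backward_path.simps backward_step.simps fl bind_map_pmf by (intro bind_pmf_cong) auto
  qed
  have pair: "pair_pmf (backward_path p (Suc t) ?z) (backward_path p (Suc t) ?w)
    = bind_pmf (bernoulli_pmf (p (u, int t - u))) (\<lambda>e. bind_pmf (bernoulli_pmf (p (w, int t - w)))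
        (\<lambda>e'. map_pmf (\<lambda>(zs, ws). (?z # zs, ?w # ws)) (?pairs e e')))"
    unfolding path pair_pmf_def
    apply (simp add: bind_assoc_pmf bind_return_pmf map_pmf_def del: backward_path.simps)
    apply (subst bind_commute_pmf[of "bernoulli_pmf (p (w, int t - w))"])
    apply simp
    done
  have step: "measure (measure_pmf (?pairs e e')) ((\<lambda>(zs, ws). (?z # zs, ?w # ws)) -` ?S)
      = pair_prob p \<eta> t (of_int (u - of_bool e) + 1 / 2) (of_int (w - of_bool e') + 1 / 2)" for e e'
    unfolding pair_prob_def
  proof (rule measure_pmf.finite_measure_eq_AE)
    have "cross_or_meet (?z # zs) (?w # ws) = cross_or_meet zs ws"
      "empty_between_ends \<eta> (?z # zs) (?w # ws) = empty_between_ends \<eta> zs ws" if "zs \<noteq> []" "ws \<noteq> []" for zs ws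
      using that assms by (simp_all add: cross_or_meet_Cons empty_between_ends_def)
    then show "AE x in ?pairs e e'. (x \<in> (\<lambda>(zs, ws). (?z # zs, ?w # ws)) -` ?S) = (x \<in> ?S)"
      using backward_path_nonempty by (auto simp: AE_measure_pmf_iff)
  qed auto
  show ?thesis
    unfolding pair_prob_def[of p \<eta> "Suc t"] pair measure_bind_bernoulli measure_map_pmf step
    by (simp add: sum_distrib_left mult.assoc del: UNIV_bool)
qed

section \<open>The Pfaffian formula for the dual particles\<close>

text \<open>
Used twice: for the particles in \<open>\<eta>\<close> at time \<open>0\<close>, and with \<open>\<eta> = UNIV\<close> to pass from distinct
neighbours to strict monotonicity.
\<close>

lemma gaps_nonempty_from_adjacent:
  fixes u :: "nat \<Rightarrow> int"
  assumes mono: "mono_on {..<m} u" and adj: "\<And>k. Suc k < m \<Longrightarrow> \<eta> \<inter> {u k<..u (Suc k)} \<noteq> {}"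
    and ij: "i < j" "j < m"
  shows "\<eta> \<inter> {u i<..u j} \<noteq> {}" "u i < u j"
proof -
  have "u (Suc i) \<le> u j"
    using mono_onD[OF mono, of "Suc i" j] ij by simp
  then have "{u i<..u (Suc i)} \<subseteq> {u i<..u j}" by auto
  then show "\<eta> \<inter> {u i<..u j} \<noteq> {}" using adj[of i] ij by fastforce
  then show "u i < u j" by auto
qed

lemma pfaffian_zero_size: "pfaffian 0 A = 1"
  by (simp add: pfaffian_def)

lemma pfaffian_cong:
  assumes "\<And>i j. i < 2 * n \<Longrightarrow> j < 2 * n \<Longrightarrow> A i j = B i j"
  shows "pfaffian n A = pfaffian n B"
proof -
  have "A (\<sigma> (2 * i)) (\<sigma> (2 * i + 1)) = B (\<sigma> (2 * i)) (\<sigma> (2 * i + 1))"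
    if \<sigma>: "\<sigma> permutes {..<2 * n}" and i: "i < n" for \<sigma> i
    using permutes_in_image[OF \<sigma>, of "2 * i"] permutes_in_image[OF \<sigma>, of "2 * i + 1"] i
    by (intro assms) simp_all
  then show ?thesis unfolding pfaffian_def by simp
qed

lemma antisym_matrix_anti: "antisym_matrix q j i = - antisym_matrix q i j"
  by (auto simp: antisym_matrix_def)

lemma antisym_matrix_pair_at:
  assumes "i < m" "j < m"
  shows "antisym_matrix q (pair_at k m i) (pair_at k m j) = antisym_matrix (\<lambda>i j. q (pair_at k m i) (pair_at k m j)) i j"
  using assms by (auto simp: antisym_matrix_def pair_at_def)

text \<open>
The matrix entry for dual vertices encoded by integers as in \<^const>\<open>dual_end\<close>.
\<close>

definition gap_prob :: "(int \<times> int \<Rightarrow> real) \<Rightarrow> int set \<Rightarrow> nat \<Rightarrow> int \<Rightarrow> int \<Rightarrow> real" where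
  "gap_prob p \<eta> t u w = pair_prob p \<eta> t (of_int u + 1 / 2) (of_int w + 1 / 2)"

definition no_wall_prob :: "(int \<times> int \<Rightarrow> real) \<Rightarrow> int set \<Rightarrow> nat \<Rightarrow> nat \<Rightarrow> (nat \<Rightarrow> int) \<Rightarrow> real" where
  "no_wall_prob p \<eta> t n u = measure (checkerboard p) {\<omega>. gaps_free \<eta> n (\<lambda>k. dual_end \<omega> t (u k))}"

lemma no_wall_prob_delete:
  assumes mono: "mono_on {..<2 * Suc n} u" and k: "k \<le> 2 * n"
    and empty: "\<And>\<omega>. \<eta> \<inter> {dual_end \<omega> t (u k)<..dual_end \<omega> t (u (Suc k))} = {}"
  shows "no_wall_prob p \<eta> t (Suc n) u = no_wall_prob p \<eta> t n (\<lambda>j. u (pair_at k (2 * n) j))"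
proof -
  have "mono_on {..<2 * Suc n} (\<lambda>j. dual_end \<omega> t (u j))" for \<omega>
    using mono by (auto intro!: mono_onI dual_end_mono dest: mono_onD)
  then have "gaps_free \<eta> (Suc n) (\<lambda>j. dual_end \<omega> t (u j))
      = gaps_free \<eta> n (\<lambda>j. dual_end \<omega> t (u (pair_at k (2 * n) j)))" for \<omega>
    by (rule gaps_free_delete[OF _ k empty])
  then show ?thesis unfolding no_wall_prob_def by simp
qed

lemma pfaffian_antisym_matrix_delete:
  assumes mono: "mono_on {..<2 * Suc n} u" and k: "k \<le> 2 * n"
    and one: "q (u k) (u (Suc k)) = 1"
    and left: "\<And>j. j < k \<Longrightarrow> q (u j) (u k) = q (u j) (u (Suc k))"
    and right: "\<And>j. Suc k < j \<Longrightarrow> j < 2 * Suc n \<Longrightarrow> q (u k) (u j) = q (u (Suc k)) (u j)"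
  shows "pfaffian (Suc n) (antisym_matrix (\<lambda>i j. q (u i) (u j)))
    = pfaffian n (antisym_matrix (\<lambda>i j. q (u (pair_at k (2 * n) i)) (u (pair_at k (2 * n) j))))"
proof -
  let ?A = "antisym_matrix (\<lambda>i j. q (u i) (u j))"
  have "pfaffian (Suc n) ?A = pfaffian n (\<lambda>i j. ?A (pair_at k (2 * n) i) (pair_at k (2 * n) j))"
  proof (rule pfaffian_delete_equal_rows[OF _ k])
    show "?A k (Suc k) = 1" using one by (simp add: antisym_matrix_def)
    show "?A j i = - ?A i j" for i j by (rule antisym_matrix_anti)
    show "?A j k = ?A j (Suc k)" if "j \<noteq> k" "j \<noteq> Suc k" "j < 2 * Suc n" for j
      using that left[of j] right[of j] by (cases "j < k") (auto simp: antisym_matrix_def)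
  qed
  also have "\<dots> = pfaffian n (antisym_matrix (\<lambda>i j. q (u (pair_at k (2 * n) i)) (u (pair_at k (2 * n) j))))"
    by (intro pfaffian_cong antisym_matrix_pair_at)
  finally show ?thesis .
qed

lemma gap_prob_0: "gap_prob p \<eta> 0 u w = of_bool (\<eta> \<inter> {u<..w} = {})"
  unfolding gap_prob_def by (rule pair_prob_0)

lemma mono_on_pair_at:
  assumes mono: "mono_on {..<2 * Suc n} u" and "k \<le> 2 * n"
  shows "mono_on {..<2 * n} (\<lambda>j. u (pair_at k (2 * n) j))"
  by (rule mono_onI, rule mono_onD[OF mono]) (auto simp: pair_at_def)

lemma sets_gaps_free:
  "{\<omega>. gaps_free \<eta> n (\<lambda>k. dual_end \<omega> t (v k))} \<in> sets (checkerboard p)"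
proof -
  have "{\<omega> \<in> space (checkerboard p). \<forall>i\<in>{..<n}. \<eta> \<inter> {dual_end \<omega> t (v (2 * i))<..dual_end \<omega> t (v (2 * i + 1))} = {}}
      \<in> sets (checkerboard p)"
    by measurable
  then show ?thesis by (simp add: gaps_free_def Ball_def)
qed

text \<open>
The first steps from distinct positions use the choices at distinct sites of one diagonal, and
the rest of the dual paths uses choices at earlier times only.
\<close>

lemma no_wall_prob_Suc:
  assumes inj: "inj_on u {..<2 * n}"
  shows "no_wall_prob p \<eta> (Suc t) n u
    = (\<Sum>c\<in>PiE {..<2 * n} (\<lambda>_. UNIV). (\<Prod>k<2 * n. pmf (bernoulli_pmf (p (u k, int t - u k))) (c k))
        * no_wall_prob p \<eta> t n (\<lambda>k. u k - of_bool (c k)))"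
proof -
  interpret prob_space "checkerboard p" by (rule prob_space_checkerboard)
  let ?C = "PiE {..<2 * n} (\<lambda>_. UNIV :: bool set)"
  let ?z = "\<lambda>k. (u k, int t - u k)"
  let ?E = "\<lambda>c \<omega>. gaps_free \<eta> n (\<lambda>k. dual_end \<omega> t (u k - of_bool (c k)))"
  let ?S = "\<lambda>c. {\<omega>. (\<forall>k<2 * n. \<omega> (?z k) = c k) \<and> ?E c \<omega>}"
  have S: "?S c \<in> sets (checkerboard p)" for c
  proof -
    have "?S c = {\<omega> \<in> space (checkerboard p). \<forall>k\<in>{..<2 * n}. \<omega> (?z k) = c k} \<inter> {\<omega>. ?E c \<omega>}" by auto
    also have "\<dots> \<in> sets (checkerboard p)"
      by (rule sets.Int[OF _ sets_gaps_free]) measurable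
    finally show ?thesis .
  qed
  have event: "gaps_free \<eta> n (\<lambda>k. dual_end \<omega> (Suc t) (u k)) = ?E c \<omega>"
    if "\<And>k. k < 2 * n \<Longrightarrow> \<omega> (?z k) = c k" for \<omega> c
    using that by (simp add: gaps_free_def)
  have "{\<omega>. gaps_free \<eta> n (\<lambda>k. dual_end \<omega> (Suc t) (u k))} = (\<Union>c\<in>?C. ?S c)"
  proof (intro equalityI subsetI)
    fix \<omega> assume "\<omega> \<in> {\<omega>. gaps_free \<eta> n (\<lambda>k. dual_end \<omega> (Suc t) (u k))}"
    then have "\<omega> \<in> ?S (restrict (\<lambda>k. \<omega> (?z k)) {..<2 * n})"
      using event[of \<omega> "restrict (\<lambda>k. \<omega> (?z k)) {..<2 * n}"] by simp
    moreover have "restrict (\<lambda>k. \<omega> (?z k)) {..<2 * n} \<in> ?C" by auto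
    ultimately show "\<omega> \<in> (\<Union>c\<in>?C. ?S c)" by blast
  next
    fix \<omega> assume "\<omega> \<in> (\<Union>c\<in>?C. ?S c)"
    then obtain c where "\<omega> \<in> ?S c" by blast
    then show "\<omega> \<in> {\<omega>. gaps_free \<eta> n (\<lambda>k. dual_end \<omega> (Suc t) (u k))}"
      using event[of \<omega> c] by blast
  qed
  then have "no_wall_prob p \<eta> (Suc t) n u = measure (checkerboard p) (\<Union>c\<in>?C. ?S c)"
    unfolding no_wall_prob_def by simp
  also have "\<dots> = (\<Sum>c\<in>?C. measure (checkerboard p) (?S c))"
  proof (rule finite_measure_finite_Union)
    show "finite ?C" by (intro finite_PiE) auto
    show "?S ` ?C \<subseteq> sets (checkerboard p)" using S by blast
    show "disjoint_family_on ?S ?C"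
    proof (unfold disjoint_family_on_def, intro ballI impI)
      fix c d assume "c \<in> ?C" "d \<in> ?C" "c \<noteq> d"
      then obtain k where "k \<in> {..<2 * n}" "c k \<noteq> d k" using PiE_ext[of c] by blast
      then show "?S c \<inter> ?S d = {}" by auto
    qed
  qed
  also have "\<dots> = (\<Sum>c\<in>?C. (\<Prod>k<2 * n. pmf (bernoulli_pmf (p (?z k))) (c k))
        * no_wall_prob p \<eta> t n (\<lambda>k. u k - of_bool (c k)))"
  proof (rule sum.cong[OF refl])
    fix c
    show "measure (checkerboard p) (?S c) = (\<Prod>k<2 * n. pmf (bernoulli_pmf (p (?z k))) (c k))
        * no_wall_prob p \<eta> t n (\<lambda>k. u k - of_bool (c k))"
      unfolding no_wall_prob_def
    proof (rule prob_fix_coordinates)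
      show "?E c (\<omega> (?z k := d)) = ?E c \<omega>" for k \<omega> d
        by (simp add: dual_end_upd)
      show "inj_on ?z {..<2 * n}" using inj by (auto simp: inj_on_def)
    qed (rule sets_gaps_free)
  qed
  finally show ?thesis .
qed

text \<open>
Induction on the time and, for fixed time, on the number of gaps. If two neighbouring dual
particles are known to have no particle of \<open>\<eta>\<close> between their ends (they coincide or, at time \<open>0\<close>,
enclose none), both sides are unchanged by deleting them, and there is one gap less. Otherwise,
at time \<open>0\<close> both sides vanish; at positive time all positions are distinct and one step of
independent moves reduces the time. After that step some positions may agree, which is why
weakly increasing positions have to be admitted.
\<close>

lemma no_wall_prob_eq_pfaffian:
  assumes "mono_on {..<2 * n} u"
  shows "no_wall_prob p \<eta> t n u = pfaffian n (antisym_matrix (\<lambda>k l. gap_prob p \<eta> t (u k) (u l)))"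
  using assms
proof (induction t arbitrary: n u)
  case 0
  then show ?case
  proof (induction n arbitrary: u)
    case 0
    show ?case
      using prob_space.prob_space[OF prob_space_checkerboard, of p]
      by (simp add: no_wall_prob_def gaps_free_def pfaffian_zero_size)
  next
    case (Suc n)
    show ?case
    proof (cases "\<exists>k\<le>2 * n. \<eta> \<inter> {u k<..u (Suc k)} = {}")
      case True
      then obtain k where k: "k \<le> 2 * n" and empty: "\<eta> \<inter> {u k<..u (Suc k)} = {}" by blast
      have le: "u i \<le> u j" if "i \<le> j" "j < 2 * Suc n" for i j
        using mono_onD[OF Suc.prems, of i j] that by auto
      have left: "gap_prob p \<eta> 0 (u j) (u k) = gap_prob p \<eta> 0 (u j) (u (Suc k))" if "j < k" for j
      proof -
        have "{u j<..u (Suc k)} = {u j<..u k} \<union> {u k<..u (Suc k)}"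
          using le[of j k] le[of k "Suc k"] that k by auto
        then show ?thesis using empty by (simp add: gap_prob_0 Int_Un_distrib)
      qed
      have right: "gap_prob p \<eta> 0 (u k) (u j) = gap_prob p \<eta> 0 (u (Suc k)) (u j)"
        if "Suc k < j" "j < 2 * Suc n" for j
      proof -
        have "{u k<..u j} = {u k<..u (Suc k)} \<union> {u (Suc k)<..u j}"
          using le[of k "Suc k"] le[of "Suc k" j] that k by auto
        then show ?thesis using empty by (simp add: gap_prob_0 Int_Un_distrib)
      qed
      have "no_wall_prob p \<eta> 0 (Suc n) u = no_wall_prob p \<eta> 0 n (\<lambda>j. u (pair_at k (2 * n) j))"
        using no_wall_prob_delete[OF Suc.prems k] empty by simp
      also have "\<dots> = pfaffian (Suc n) (antisym_matrix (\<lambda>k l. gap_prob p \<eta> 0 (u k) (u l)))"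
        unfolding Suc.IH[OF mono_on_pair_at[OF Suc.prems k]]
        using empty left right
        by (intro pfaffian_antisym_matrix_delete[OF Suc.prems k, symmetric]) (simp_all add: gap_prob_0)
      finally show ?thesis .
    next
      case False
      have ne: "\<eta> \<inter> {u i<..u j} \<noteq> {}" if "i < j" "j < 2 * Suc n" for i j
        using gaps_nonempty_from_adjacent(1)[OF Suc.prems _ that, of \<eta>] False by auto
      have "pfaffian (Suc n) (antisym_matrix (\<lambda>k l. gap_prob p \<eta> 0 (u k) (u l)))
          = pfaffian (Suc n) (\<lambda>_ _. 0)"
        by (rule pfaffian_cong) (use ne in \<open>auto simp: antisym_matrix_def gap_prob_0\<close>)
      also have "\<dots> = 0" by (simp add: pfaffian_def)
      finally show ?thesis
        using ne[of 0 1] by (force simp: no_wall_prob_def gaps_free_def)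
    qed
  qed
next
  case (Suc t)
  note IH_time = Suc.IH
  from Suc.prems show ?case
  proof (induction n arbitrary: u)
    case 0
    show ?case
      using prob_space.prob_space[OF prob_space_checkerboard, of p]
      by (simp add: no_wall_prob_def gaps_free_def pfaffian_zero_size)
  next
    case (Suc n)
    show ?case
    proof (cases "\<exists>k\<le>2 * n. u k = u (Suc k)")
      case True
      then obtain k where k: "k \<le> 2 * n" and meet: "u k = u (Suc k)" by blast
      have "no_wall_prob p \<eta> (Suc t) (Suc n) u = no_wall_prob p \<eta> (Suc t) n (\<lambda>j. u (pair_at k (2 * n) j))"
        using no_wall_prob_delete[OF Suc.prems k] meet by simp
      also have "\<dots> = pfaffian (Suc n) (antisym_matrix (\<lambda>k l. gap_prob p \<eta> (Suc t) (u k) (u l)))"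
        unfolding Suc.IH[OF mono_on_pair_at[OF Suc.prems k]]
        by (intro pfaffian_antisym_matrix_delete[OF Suc.prems k, symmetric])
          (simp_all add: meet gap_prob_def pair_prob_meeting)
      finally show ?thesis .
    next
      case False
      let ?N = "Suc n"
      have less: "u i < u j" if "i < j" "j < 2 * ?N" for i j
      proof (rule gaps_nonempty_from_adjacent(2)[OF Suc.prems _ that, of UNIV])
        fix k assume "Suc k < 2 * ?N"
        then have "u k < u (Suc k)"
          using False mono_onD[OF Suc.prems, of k "Suc k"] by (force simp: less_le)
        then show "UNIV \<inter> {u k<..u (Suc k)} \<noteq> {}" by auto
      qed
      let ?w = "\<lambda>k. pmf (bernoulli_pmf (p (u k, int t - u k)))"
      let ?q = "\<lambda>k l e e'. gap_prob p \<eta> t (u k - of_bool e) (u l - of_bool e')"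
      let ?X = "\<lambda>k l e e'. if k < l then ?q k l e e' else if l < k then - ?q l k e' e else 0"
      have inj: "inj_on u {..<2 * ?N}"
        by (rule linorder_inj_onI) (use less in fastforce)+
      have "no_wall_prob p \<eta> (Suc t) ?N u
          = (\<Sum>c\<in>PiE {..<2 * ?N} (\<lambda>_. UNIV). (\<Prod>k<2 * ?N. ?w k (c k))
              * no_wall_prob p \<eta> t ?N (\<lambda>k. u k - of_bool (c k)))"
        by (rule no_wall_prob_Suc[OF inj])
      also have "\<dots> = (\<Sum>c\<in>PiE {..<2 * ?N} (\<lambda>_. UNIV). (\<Prod>k<2 * ?N. ?w k (c k))
              * pfaffian ?N (\<lambda>k l. ?X k l (c k) (c l)))"
      proof (rule sum.cong[OF refl])
        fix c :: "nat \<Rightarrow> bool"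
        have "mono_on {..<2 * ?N} (\<lambda>k. u k - of_bool (c k))"
        proof (rule mono_onI)
          fix i j assume "i \<in> {..<2 * ?N}" "j \<in> {..<2 * ?N}" "i \<le> j"
          then show "u i - of_bool (c i) \<le> u j - of_bool (c j)"
            using less[of i j] by (cases "i = j") auto
        qed
        from IH_time[OF this] show "(\<Prod>k<2 * ?N. ?w k (c k)) * no_wall_prob p \<eta> t ?N (\<lambda>k. u k - of_bool (c k))
            = (\<Prod>k<2 * ?N. ?w k (c k)) * pfaffian ?N (\<lambda>k l. ?X k l (c k) (c l))"
          by (simp add: antisym_matrix_def[abs_def])
      qed
      also have "\<dots> = pfaffian ?N (\<lambda>k l. \<Sum>e\<in>UNIV. \<Sum>e'\<in>UNIV. ?w k e * ?w l e' * ?X k l e e')"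
        by (rule pfaffian_expectation)
      also have "\<dots> = pfaffian ?N (antisym_matrix (\<lambda>k l. gap_prob p \<eta> (Suc t) (u k) (u l)))"
      proof (rule pfaffian_cong)
        fix k l assume kl: "k < 2 * ?N" "l < 2 * ?N"
        have step: "gap_prob p \<eta> (Suc t) (u k) (u l)
            = (\<Sum>e\<in>UNIV. \<Sum>e'\<in>UNIV. ?w k e * ?w l e' * ?q k l e e')" if "k < l" "l < 2 * ?N" for k l
          unfolding gap_prob_def by (rule pair_prob_Suc[OF less[OF that]])
        consider "k < l" | "l < k" | "k = l" by linarith
        then show "(\<Sum>e\<in>UNIV. \<Sum>e'\<in>UNIV. ?w k e * ?w l e' * ?X k l e e')
            = antisym_matrix (\<lambda>k l. gap_prob p \<eta> (Suc t) (u k) (u l)) k l"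
        proof cases
          case 1
          then show ?thesis using step[OF 1 kl(2)] by (simp add: antisym_matrix_def del: UNIV_bool)
        next
          case 2
          have "(\<Sum>e\<in>UNIV. \<Sum>e'\<in>UNIV. ?w k e * ?w l e' * ?X k l e e')
              = - (\<Sum>e\<in>UNIV. \<Sum>e'\<in>UNIV. ?w l e' * ?w k e * ?q l k e' e)"
            using 2 by (simp add: sum_negf mult.commute del: UNIV_bool)
          also have "\<dots> = - gap_prob p \<eta> (Suc t) (u l) (u k)"
            unfolding step[OF 2 kl(1)] by (subst sum.swap) (rule refl)
          finally show ?thesis using 2 by (simp add: antisym_matrix_def)
        qed (simp add: antisym_matrix_def)
      qed
      finally show ?thesis .
    qed
  qed
qed

theorem theorem7p1:
  fixes p :: "int \<times> int \<Rightarrow> real" and \<eta> :: "int set" and T n :: nat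
    and a b :: "nat \<Rightarrow> real"
  assumes "\<And>z. 0 \<le> p z \<and> p z \<le> 1"
    and "1 \<le> T" and "1 \<le> n"
    and "\<And>i. i < n \<Longrightarrow> a i \<in> half_ints" and "\<And>i. i < n \<Longrightarrow> b i \<in> half_ints"
    and "\<And>i. i < n \<Longrightarrow> a i < b i"
    and "\<And>i. Suc i < n \<Longrightarrow> b i \<le> a (Suc i)"
  shows "\<P>(\<omega> in checkerboard p.
           \<forall>i<n. real_of_int ` walls \<eta> T \<omega> \<inter> {a i <..< b i} = {})
         = pfaffian n (antisym_matrix
             (\<lambda>k l. pair_prob p \<eta> T (endpoints a b k) (endpoints a b l)))"
proof -
  define u where "u k = \<lfloor>endpoints a b k\<rfloor>" for k
  have half: "x = of_int \<lfloor>x\<rfloor> + 1 / 2" if "x \<in> half_ints" for x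
    using that by (auto simp: half_ints_def floor_eq_iff)
  have u: "endpoints a b k = of_int (u k) + 1 / 2" if "k < 2 * n" for k
    unfolding u_def using that assms(4,5)[of "k div 2"] by (intro half) (auto simp: endpoints_def)
  have adj: "endpoints a b k \<le> endpoints a b (Suc k)" if "Suc k < 2 * n" for k
  proof (cases "even k")
    case True
    moreover have "k div 2 < n" using that by linarith
    ultimately show ?thesis using assms(6)[of "k div 2"] by (simp add: endpoints_def)
  next
    case False
    then have "Suc k div 2 = Suc (k div 2)" by simp
    moreover have "Suc (k div 2) < n" using that False by (auto elim!: oddE)
    ultimately show ?thesis using False assms(7)[of "k div 2"] by (simp add: endpoints_def)
  qed
  have mono: "mono_on {..<2 * n} u"
  proof (rule mono_onI)
    fix i j assume "i \<in> {..<2 * n}" "j \<in> {..<2 * n}" "i \<le> j"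
    from this(3,2) show "u i \<le> u j"
    proof (induction j rule: dec_induct)
      case (step j)
      have "u j \<le> u (Suc j)" unfolding u_def using adj[of j] step.prems by (intro floor_mono) simp
      then show ?case using step by simp
    qed simp
  qed
  have event: "(\<forall>i<n. real_of_int ` walls \<eta> T \<omega> \<inter> {a i <..< b i} = {})
      \<longleftrightarrow> gaps_free \<eta> n (\<lambda>k. dual_end \<omega> T (u k))" for \<omega>
  proof -
    have "real_of_int ` walls \<eta> T \<omega> \<inter> {a i <..< b i} = {} \<longleftrightarrow>
        \<eta> \<inter> {dual_end \<omega> T (u (2 * i))<..dual_end \<omega> T (u (2 * i + 1))} = {}" if "i < n" for i
    proof -
      have ab: "a i = of_int (u (2 * i)) + 1 / 2" "b i = of_int (u (2 * i + 1)) + 1 / 2"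
        using u[of "2 * i"] u[of "2 * i + 1"] that by (simp_all add: endpoints_def)
      have "real_of_int m \<in> {a i <..< b i} \<longleftrightarrow> m \<in> {u (2 * i)<..u (2 * i + 1)}" for m
        unfolding ab by auto
      then have "real_of_int ` walls \<eta> T \<omega> \<inter> {a i <..< b i} = {}
          \<longleftrightarrow> walls \<eta> T \<omega> \<inter> {u (2 * i)<..u (2 * i + 1)} = {}" by blast
      then show ?thesis by (simp only: no_wall_iff_dual)
    qed
    then show ?thesis by (simp add: gaps_free_def)
  qed
  have "\<P>(\<omega> in checkerboard p. \<forall>i<n. real_of_int ` walls \<eta> T \<omega> \<inter> {a i <..< b i} = {})
      = no_wall_prob p \<eta> T n u"
    by (simp add: event no_wall_prob_def)
  also have "\<dots> = pfaffian n (antisym_matrix (\<lambda>k l. gap_prob p \<eta> T (u k) (u l)))"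
    by (rule no_wall_prob_eq_pfaffian[OF mono])
  also have "\<dots> = pfaffian n (antisym_matrix (\<lambda>k l. pair_prob p \<eta> T (endpoints a b k) (endpoints a b l)))"
    by (rule pfaffian_cong) (simp add: antisym_matrix_def gap_prob_def u)
  finally show ?thesis .
qed

end
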